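(* Let $\pi\in\Pi$ and $\lambda>0$, and define $U^\lambda_L(\pi)=\min_h U^{\lambda,h}_L(\pi)$, the minimum being taken over all functions $h:[0,1]^2\times[-1,0]\to(-\infty,0]$ satisfying $pc/q\le h(p,q,c)\le 0$ for all $(p,q,c)\in[0,1]^2\times[-1,0]$. Then, for any $\lambda>0$ and any $L>1$, $$U^\lambda_L(\pi)\le U^\lambda_1(\pi).$$ In particular, for any $\lambda>0$, $U^\lambda_\infty(\pi)\le U^\lambda_1(\pi)$.
   Context: Setting (offline contextual bandit). $\mathcal{X}\subset\mathbb{R}^d$ is a compact context space, $\mathcal{A}=\{1,\dots,K\}$ a finite action set. A policy $\pi$ assigns to each $x\in\mathcal{X}$ a probability distribution $\pi(\cdot|x)$ on $\mathcal{A}$; $\Pi$ is the set of policies and $\pi_0$ is a fixed behavior policy. The logged data is $(x_i,a_i,c_i)_{i\in[n]}$ with $x_i\in\mathcal{X}$, $a_i\in\mathcal{A}$ drawn from $\pi_0(\cdot|x_i)$ (so $\pi_0(a_i|x_i)>0$), and costs $c_i\in[-1,0]$. The statement holds for any realization of the data and any fixed $\delta\in(0,1]$. Notation. $h_i = h(\pi(a_i|x_i),\pi_0(a_i|x_i),c_i)$; $\hat{R}^h_n(\pi)=\frac1n\sum_{i=1}^n h_i$; $\hat{\mathcal{M}}^{h,\ell}_n(\pi)=\frac1n\sum_{i=1}^n h_i^\ell$; $\psi_\lambda(x)=\frac1\lambda(1-e^{-\lambda x})$ for $x\in\mathbb{R}$. For an integer $L\ge1$, $$U^{\lambda,h}_L(\pi)=\psi_\lambda\Big(\hat{R}^h_n(\pi)+\sum_{\ell=2}^{2L}\frac{\lambda^{\ell-1}}{\ell}\hat{\mathcal{M}}^{h,\ell}_n(\pi)+\frac{\ln(1/\delta)}{\lambda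 n}\Big),$$ and for $L=\infty$, $$U^{\lambda,h}_\infty(\pi)=\psi_\lambda\Big(-\frac1n\sum_{i=1}^n\frac1\lambda\log(1-\lambda h_i)+\frac{\ln(1/\delta)}{\lambda n}\Big).$$ *)

theory Defs
  imports "HOL-Probability.Probability" "HOL-Library.Extended_Nat"
begin

text \<open>
  The logged data \<open>(x\<^sub>i, a\<^sub>i, c\<^sub>i)\<close> is a sequence of triples, of which only the
  indices \<open>1, \<dots>, n\<close> matter.
\<close>

type_synonym 'd log = "nat \<Rightarrow> (real ^ 'd) \<times> nat \<times> real"

type_synonym 'd policy = "real ^ 'd \<Rightarrow> nat pmf"

text \<open>A policy is a total function; its values outside the context space are unconstrained.\<close>

definition policies :: "(real ^ 'd) set \<Rightarrow> nat \<Rightarrow> 'd policy set" where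
  "policies X K = {\<pi>. \<forall>x\<in>X. set_pmf (\<pi> x) \<subseteq> {1..K}}"

definition logged_data ::
    "(real ^ 'd) set \<Rightarrow> nat \<Rightarrow> 'd policy \<Rightarrow> nat \<Rightarrow> 'd log \<Rightarrow> bool" where
  "logged_data X K \<pi>0 n D \<longleftrightarrow>
     (\<forall>i\<in>{1..n}. case D i of (x, a, c) \<Rightarrow>
        x \<in> X \<and> a \<in> {1..K} \<and> pmf (\<pi>0 x) a > 0 \<and> c \<in> {-1..0})"

definition reg_domain :: "(real \<times> real \<times> real) set" where
  "reg_domain = {0..1} \<times> {0..1} \<times> {-1..0}"

text \<open>
  The lower bound \<open>p c / q\<close> is imposed only for \<open>q > 0\<close>: at \<open>q = 0\<close> it is to be read as
  \<open>-\<infinity>\<close> (no constraint), whereas HOL's \<open>p * c / 0 = 0\<close> would force \<open>h = 0\<close> there.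
\<close>

definition regularizers :: "(real \<times> real \<times> real \<Rightarrow> real) set" where
  "regularizers = {h \<in> reg_domain \<rightarrow> {..0}.
     \<forall>(p, q, c)\<in>reg_domain. (q > 0 \<longrightarrow> p * c / q \<le> h (p, q, c)) \<and> h (p, q, c) \<le> 0}"

definition h_val ::
    "'d policy \<Rightarrow> 'd log \<Rightarrow> (real \<times> real \<times> real \<Rightarrow> real) \<Rightarrow> 'd policy \<Rightarrow> nat \<Rightarrow> real" where
  "h_val \<pi>0 D h \<pi> i = (case D i of (x, a, c) \<Rightarrow> h (pmf (\<pi> x) a, pmf (\<pi>0 x) a, c))"

definition emp_risk ::
    "'d policy \<Rightarrow> nat \<Rightarrow> 'd log \<Rightarrow> (real \<times> real \<times> real \<Rightarrow> real) \<Rightarrow> 'd policy \<Rightarrow> real" where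
  "emp_risk \<pi>0 n D h \<pi> = 1 / real n * (\<Sum>i=1..n. h_val \<pi>0 D h \<pi> i)"

definition emp_moment ::
    "'d policy \<Rightarrow> nat \<Rightarrow> 'd log \<Rightarrow> (real \<times> real \<times> real \<Rightarrow> real) \<Rightarrow> nat \<Rightarrow> 'd policy \<Rightarrow> real" where
  "emp_moment \<pi>0 n D h l \<pi> = 1 / real n * (\<Sum>i=1..n. h_val \<pi>0 D h \<pi> i ^ l)"

definition psi :: "real \<Rightarrow> real \<Rightarrow> real" where
  "psi lam x = 1 / lam * (1 - exp (- lam * x))"

definition U_bound ::
    "'d policy \<Rightarrow> nat \<Rightarrow> 'd log \<Rightarrow> real \<Rightarrow> real \<Rightarrow> enat \<Rightarrow> 'd policy
      \<Rightarrow> (real \<times> real \<times> real \<Rightarrow> real) \<Rightarrow> real" where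
  "U_bound \<pi>0 n D \<delta> lam L \<pi> h = (case L of
     enat m \<Rightarrow>
       psi lam (emp_risk \<pi>0 n D h \<pi>
         + (\<Sum>l=2..2*m. lam ^ (l - 1) / real l * emp_moment \<pi>0 n D h l \<pi>)
         + ln (1 / \<delta>) / (lam * real n))
   | \<infinity> \<Rightarrow>
       psi lam (- (1 / real n) * (\<Sum>i=1..n. 1 / lam * ln (1 - lam * h_val \<pi>0 D h \<pi> i))
         + ln (1 / \<delta>) / (lam * real n)))"

text \<open>
  The minimum over \<open>h\<close> is the least element of the set of attained values; it is meaningful
  only when a minimizer exists.
\<close>

definition U_min ::
    "'d policy \<Rightarrow> nat \<Rightarrow> 'd log \<Rightarrow> real \<Rightarrow> real \<Rightarrow> enat \<Rightarrow> 'd policy \<Rightarrow> real" where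
  "U_min \<pi>0 n D \<delta> lam L \<pi> = (LEAST u. u \<in> U_bound \<pi>0 n D \<delta> lam L \<pi> ` regularizers)"

end

theory Submission
  imports Defs
begin

text \<open>
  Each bound is an increasing function of the average of \<open>term_fn lam L (h\<^sub>i)\<close>, and \<open>h\<close> may be
  chosen independently at each point \<open>(p, q, c)\<close>; a minimizer is therefore obtained by minimizing
  a continuous function on each compact interval \<open>[p c / q, 0]\<close>.

  For the comparison, raising \<open>h\<close> to \<open>max h (- 1 / lam)\<close> does not increase the quadratic bound,
  whose summand \<open>y + lam y\<^sup>2 / 2\<close> has its vertex at \<open>- 1 / lam\<close>. On \<open>[- 1 / lam, 0]\<close> the
  consecutive terms of degrees \<open>2 m + 1\<close> and \<open>2 m + 2\<close> have a nonpositive sum, so there the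
  summand of order \<open>L\<close> is at most the quadratic one; for \<open>L = \<infinity>\<close> this is
  \<open>s - s\<^sup>2 / 2 \<le> ln (1 + s)\<close> with \<open>s = - lam y\<close>.
\<close>

text \<open>For finite orders this is the Taylor polynomial at 0, of degree \<open>2 * m\<close>, of
  the function used at order \<infinity>.\<close>

definition term_fn :: "real \<Rightarrow> enat \<Rightarrow> real \<Rightarrow> real" where
  "term_fn lam L y = (case L of
     enat m \<Rightarrow> y + (\<Sum>l=2..2*m. lam ^ (l - 1) / real l * y ^ l)
   | \<infinity> \<Rightarrow> - (1 / lam * ln (1 - lam * y)))"

lemma U_bound_term_fn:
  "U_bound \<pi>0 n D \<delta> lam L \<pi> h =
     psi lam (1 / real n * (\<Sum>i=1..n. term_fn lam L (h_val \<pi>0 D h \<pi> i)) + ln (1 / \<delta>) / (lam * real n))"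
proof (cases L)
  case (enat m)
  have "(\<Sum>l=2..2*m. lam ^ (l - 1) / real l * emp_moment \<pi>0 n D h l \<pi>)
      = 1 / real n * (\<Sum>l=2..2*m. \<Sum>i=1..n. lam ^ (l - 1) / real l * h_val \<pi>0 D h \<pi> i ^ l)"
    unfolding emp_moment_def sum_distrib_left by (simp add: mult_ac)
  also have "\<dots> = 1 / real n * (\<Sum>i=1..n. \<Sum>l=2..2*m. lam ^ (l - 1) / real l * h_val \<pi>0 D h \<pi> i ^ l)"
    by (subst sum.swap) (rule refl)
  finally show ?thesis
    using enat by (simp add: U_bound_def term_fn_def emp_risk_def sum.distrib distrib_left)
next
  case infinity
  then show ?thesis
    by (simp add: U_bound_def term_fn_def sum_negf)
qed

lemma psi_mono:
  assumes "lam > 0" "x \<le> y"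
  shows "psi lam x \<le> psi lam y"
  using assms by (simp add: psi_def divide_right_mono)

text \<open>Order and regularizer may both change: \<open>L = L'\<close> serves the existence of
  minimizers, \<open>L' = 1\<close> the comparison of orders.\<close>

lemma U_bound_mono:
  assumes "lam > 0"
    and "\<And>i. i \<in> {1..n} \<Longrightarrow>
      term_fn lam L (h_val \<pi>0 D h \<pi> i) \<le> term_fn lam L' (h_val \<pi>0 D h' \<pi> i)"
  shows "U_bound \<pi>0 n D \<delta> lam L \<pi> h \<le> U_bound \<pi>0 n D \<delta> lam L' \<pi> h'"
  unfolding U_bound_term_fn using assms
  by (intro psi_mono add_right_mono mult_left_mono sum_mono) auto

lemma continuous_on_term_fn:
  assumes "lam > 0"
  shows "continuous_on {..0} (term_fn lam L)"
proof (cases L)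
  case (enat m)
  then show ?thesis
    unfolding term_fn_def by (auto intro!: continuous_intros)
next
  case infinity
  have "1 - lam * y \<noteq> 0" if "y \<le> 0" for y
    using assms mult_nonneg_nonpos[of lam y] that by linarith
  then show ?thesis
    unfolding term_fn_def infinity using assms by (auto intro!: continuous_intros)
qed

text \<open>The difference of the two sides vanishes at 0 and has derivative
  \<open>x\<^sup>2 / (1 + x)\<close>.\<close>

lemma ln_one_plus_ge_quadratic:
  fixes s :: real
  assumes "s \<ge> 0"
  shows "s - s\<^sup>2 / 2 \<le> ln (1 + s)"
proof -
  have "(\<lambda>x::real. ln (1 + x) - x + x\<^sup>2 / 2) 0 \<le> (\<lambda>x. ln (1 + x) - x + x\<^sup>2 / 2) s"
  proof (rule DERIV_nonneg_imp_nondecreasing[OF assms])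
    fix x :: real
    assume x: "0 \<le> x" "x \<le> s"
    have "((\<lambda>x. ln (1 + x) - x + x\<^sup>2 / 2) has_real_derivative (1 / (1 + x) - 1 + x)) (at x)"
      using x by (auto intro!: derivative_eq_intros)
    moreover
    have "1 / (1 + x) - 1 + x = x\<^sup>2 / (1 + x)"
      using x by (simp add: field_simps power2_eq_square)
    then have "0 \<le> 1 / (1 + x) - 1 + x"
      using x by simp
    ultimately show "\<exists>y. ((\<lambda>x. ln (1 + x) - x + x\<^sup>2 / 2) has_real_derivative y) (at x) \<and> 0 \<le> y"
      by blast
  qed
  then show ?thesis by simp
qed

lemma term_fn_one: "term_fn lam 1 y = y + lam / 2 * y\<^sup>2"
  by (simp add: term_fn_def one_enat_def)

lemma term_fn_enat_le_one:
  assumes "lam > 0" "y \<le> 0" "- 1 \<le> lam * y" "m \<ge> 1"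
  shows "term_fn lam (enat m) y \<le> term_fn lam 1 y"
  using \<open>m \<ge> 1\<close>
proof (induction m rule: dec_induct)
  case base
  then show ?case by (simp add: one_enat_def)
next
  case (step m)
  have "term_fn lam (enat (Suc m)) y
      = term_fn lam (enat m) y
        + (lam ^ (2*m) / real (2*m+1) * y ^ (2*m+1) + lam ^ (2*m+1) / real (2*m+2) * y ^ (2*m+2))"
    using step.hyps by (simp add: term_fn_def)
  \<comment> \<open>Factoring out an even power, which is nonnegative, leaves only the sign of the
    last factor to settle.\<close>
  moreover have "lam ^ (2*m) / real (2*m+1) * y ^ (2*m+1) + lam ^ (2*m+1) / real (2*m+2) * y ^ (2*m+2)
      = (lam * y) ^ (2*m) * (y * (1 / real (2*m+1) + lam * y / real (2*m+2)))"
    by (simp add: power_mult_distrib power_add power2_eq_square distrib_left mult_ac)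
  moreover have "y * (1 / real (2*m+1) + lam * y / real (2*m+2)) \<le> 0"
  proof (rule mult_nonpos_nonneg)
    have "- 1 / real (2*m+2) \<le> lam * y / real (2*m+2)"
      using assms by (intro divide_right_mono) auto
    moreover have "1 / real (2*m+2) \<le> 1 / real (2*m+1)"
      by (intro divide_left_mono) auto
    ultimately show "0 \<le> 1 / real (2*m+1) + lam * y / real (2*m+2)"
      by linarith
  qed (fact assms)
  ultimately show ?case
    using step.IH mult_nonneg_nonpos[of "(lam * y) ^ (2*m)"] by fastforce
qed

lemma term_fn_le_one:
  assumes "lam > 0" "y \<le> 0" "- 1 \<le> lam * y" "L \<ge> 1"
  shows "term_fn lam L y \<le> term_fn lam 1 y"
proof (cases L)
  case (enat m)
  then show ?thesis
    using assms term_fn_enat_le_one by (simp add: one_enat_def)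
next
  case infinity
  \<comment> \<open>Dividing by \<open>- lam\<close> reverses this inequality into the
    claim.\<close>
  have "- (lam * y) - (- (lam * y))\<^sup>2 / 2 \<le> ln (1 + - (lam * y))"
    using assms by (intro ln_one_plus_ge_quadratic) (simp add: mult_nonneg_nonpos)
  then show ?thesis
    using assms infinity
    by (simp add: term_fn_one) (simp add: term_fn_def field_simps power2_eq_square)
qed

lemma term_fn_max_le_one:
  assumes "lam > 0" "y \<le> 0" "L \<ge> 1"
  shows "term_fn lam L (max y (- 1 / lam)) \<le> term_fn lam 1 y"
proof -
  have "- 1 = lam * (- 1 / lam)"
    using assms by simp
  also have "\<dots> \<le> lam * max y (- 1 / lam)"
    using assms by (intro mult_left_mono) auto
  finally have "term_fn lam L (max y (- 1 / lam)) \<le> term_fn lam 1 (max y (- 1 / lam))"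
    using assms by (intro term_fn_le_one) auto
  also have "\<dots> \<le> term_fn lam 1 y"
  proof -
    \<comment> \<open>Completing the square at the vertex \<open>- w\<close>. With \<open>w\<close>
      opaque the identity is polynomial, and its defect is a multiple of
      \<open>lam * w - 1 = 0\<close>.\<close>
    define w where "w = 1 / lam"
    have "lam * w = 1"
      using assms by (simp add: w_def)
    moreover have "- w + lam / 2 * w\<^sup>2 + lam / 2 * (y + w)\<^sup>2 - (y + lam / 2 * y\<^sup>2) = (lam * w - 1) * (y + w)"
      by (simp add: field_simps power2_eq_square)
    ultimately have "y + lam / 2 * y\<^sup>2 = - w + lam / 2 * w\<^sup>2 + lam / 2 * (y + w)\<^sup>2"
      by simp
    then have "term_fn lam 1 y = term_fn lam 1 (- 1 / lam) + lam / 2 * (y + w)\<^sup>2"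
      by (simp add: term_fn_one w_def)
    then have "term_fn lam 1 (- 1 / lam) \<le> term_fn lam 1 y"
      using assms by simp
    then show ?thesis by (simp add: max_def)
  qed
  finally show ?thesis .
qed

lemma regularizers_iff:
  "h \<in> regularizers \<longleftrightarrow>
     (\<forall>p q c. (p, q, c) \<in> reg_domain \<longrightarrow> (q > 0 \<longrightarrow> p * c / q \<le> h (p, q, c)) \<and> h (p, q, c) \<le> 0)"
  unfolding regularizers_def by auto

lemma max_regularizer:
  assumes "h \<in> regularizers" "b \<le> 0"
  shows "(\<lambda>z. max (h z) b) \<in> regularizers"
  using assms unfolding regularizers_iff by (auto simp: le_max_iff_disj)

text \<open>The point is the same for all \<open>h\<close>, so regularizers are compared datum by
  datum; \<open>q > 0\<close> makes the lower bound \<open>p * c / q\<close> available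
  there.\<close>

lemma h_val_logged:
  assumes "logged_data X K \<pi>0 n D" "i \<in> {1..n}"
  obtains p q c where "(p, q, c) \<in> reg_domain" "q > 0" "\<And>h. h_val \<pi>0 D h \<pi> i = h (p, q, c)"
proof -
  obtain x a c where D: "D i = (x, a, c)"
    by (cases "D i") auto
  then have "pmf (\<pi>0 x) a > 0" "c \<in> {-1..0}"
    using assms unfolding logged_data_def by force+
  then show thesis
    using that[of "pmf (\<pi> x) a" "pmf (\<pi>0 x) a" c] D
    by (simp add: reg_domain_def h_val_def pmf_le_1)
qed

text \<open>Admissibility constrains each point separately, so one \<open>h\<close> can minimize at
  all of them. Points with \<open>q = 0\<close> are excluded because competitors are unbounded below
  there.\<close>

lemma pointwise_minimal_regularizer:
  assumes "lam > 0"
  obtains h where "h \<in> regularizers"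
    "\<And>p q c h'. \<lbrakk>(p, q, c) \<in> reg_domain; q > 0; h' \<in> regularizers\<rbrakk> \<Longrightarrow>
      term_fn lam L (h (p, q, c)) \<le> term_fn lam L (h' (p, q, c))"
proof -
  have min: "\<exists>y\<in>{a..0}. \<forall>y'\<in>{a..0}. term_fn lam L y \<le> term_fn lam L y'" if "a \<le> 0" for a
    using that continuous_on_subset[OF continuous_on_term_fn[OF assms]]
    by (intro continuous_attains_inf) auto
  define m where "m a = (SOME y. y \<in> {a..0} \<and> (\<forall>y'\<in>{a..0}. term_fn lam L y \<le> term_fn lam L y'))" for a
  have m: "m a \<in> {a..0} \<and> (\<forall>y'\<in>{a..0}. term_fn lam L (m a) \<le> term_fn lam L y')" if "a \<le> 0" for a
    unfolding m_def using min[OF that] by (rule someI2_bex) blast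
  have le0: "p * c / q \<le> 0" if "(p, q, c) \<in> reg_domain" for p q c
    using that by (auto simp: reg_domain_def intro!: divide_nonpos_nonneg mult_nonneg_nonpos)
  \<comment> \<open>At \<open>q = 0\<close> the quotient is 0 in HOL, so the interval is
    \<open>{0}\<close> and the value 0 is admissible.\<close>
  let ?h = "\<lambda>(p, q, c). m (p * c / q)"
  show thesis
  proof
    show "?h \<in> regularizers"
      using m le0 unfolding regularizers_iff by auto
    show "term_fn lam L (?h (p, q, c)) \<le> term_fn lam L (h' (p, q, c))"
      if "(p, q, c) \<in> reg_domain" "q > 0" "h' \<in> regularizers" for p q c h'
      using m[OF le0[OF that(1)]] that unfolding regularizers_iff by auto
  qed
qed

lemma U_bound_attains_min:
  assumes "logged_data X K \<pi>0 n D" "lam > 0"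
  shows "\<exists>h. is_arg_min (U_bound \<pi>0 n D \<delta> lam L \<pi>) (\<lambda>h. h \<in> regularizers) h"
proof -
  obtain h where h: "h \<in> regularizers"
    "\<And>p q c h'. \<lbrakk>(p, q, c) \<in> reg_domain; q > 0; h' \<in> regularizers\<rbrakk> \<Longrightarrow>
      term_fn lam L (h (p, q, c)) \<le> term_fn lam L (h' (p, q, c))"
    using pointwise_minimal_regularizer[OF assms(2)] by blast
  have "U_bound \<pi>0 n D \<delta> lam L \<pi> h \<le> U_bound \<pi>0 n D \<delta> lam L \<pi> h'" if "h' \<in> regularizers" for h'
  proof (rule U_bound_mono[OF assms(2)])
    fix i assume "i \<in> {1..n}"
    then show "term_fn lam L (h_val \<pi>0 D h \<pi> i) \<le> term_fn lam L (h_val \<pi>0 D h' \<pi> i)"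
      using h_val_logged[OF assms(1)] h(2) that by metis
  qed
  with h(1) show ?thesis
    by (auto simp: is_arg_min_linorder)
qed

text \<open>A set of reals need not have a least element; the minimizer supplies the one that
  \<open>LEAST\<close> denotes.\<close>

lemma U_min_eq:
  assumes "is_arg_min (U_bound \<pi>0 n D \<delta> lam L \<pi>) (\<lambda>h. h \<in> regularizers) h"
  shows "U_min \<pi>0 n D \<delta> lam L \<pi> = U_bound \<pi>0 n D \<delta> lam L \<pi> h"
  using assms unfolding U_min_def by (intro Least_equality) (auto simp: is_arg_min_linorder)

lemma U_min_le_one:
  assumes "logged_data X K \<pi>0 n D" "lam > 0" "L \<ge> 1"
  shows "U_min \<pi>0 n D \<delta> lam L \<pi> \<le> U_min \<pi>0 n D \<delta> lam 1 \<pi>"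
proof -
  obtain h where h: "is_arg_min (U_bound \<pi>0 n D \<delta> lam L \<pi>) (\<lambda>h. h \<in> regularizers) h"
    using U_bound_attains_min[OF assms(1,2)] by blast
  obtain h1 where h1: "is_arg_min (U_bound \<pi>0 n D \<delta> lam 1 \<pi>) (\<lambda>h. h \<in> regularizers) h1"
    using U_bound_attains_min[OF assms(1,2)] by blast
  then have reg: "h1 \<in> regularizers"
    by (simp add: is_arg_min_def)
  \<comment> \<open>The quadratic minimizer, clipped at the vertex, is the competitor at order
    \<open>L\<close>.\<close>
  let ?h = "\<lambda>z. max (h1 z) (- 1 / lam)"
  have "?h \<in> regularizers"
    using max_regularizer[OF reg] assms(2) by simp
  with h have "U_bound \<pi>0 n D \<delta> lam L \<pi> h \<le> U_bound \<pi>0 n D \<delta> lam L \<pi> ?h"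
    by (simp add: is_arg_min_linorder)
  also have "\<dots> \<le> U_bound \<pi>0 n D \<delta> lam 1 \<pi> h1"
  proof (rule U_bound_mono[OF assms(2)])
    fix i assume "i \<in> {1..n}"
    then obtain p q c where z: "(p, q, c) \<in> reg_domain" "\<And>h. h_val \<pi>0 D h \<pi> i = h (p, q, c)"
      using h_val_logged[OF assms(1)] by metis
    then have "h1 (p, q, c) \<le> 0"
      using reg unfolding regularizers_iff by blast
    then show "term_fn lam L (h_val \<pi>0 D ?h \<pi> i) \<le> term_fn lam 1 (h_val \<pi>0 D h1 \<pi> i)"
      unfolding z(2) using assms by (intro term_fn_max_le_one)
  qed
  finally show ?thesis
    unfolding U_min_eq[OF h] U_min_eq[OF h1] .
qed

theorem proposition3:
  fixes X :: "(real ^ 'd) set" and K n :: nat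
    and \<pi>0 \<pi> :: "'d policy" and D :: "'d log"
    and \<delta> lam :: real
  assumes "compact X"
    and "n \<ge> 1"
    and "\<pi>0 \<in> policies X K"
    and "\<pi> \<in> policies X K"
    and "logged_data X K \<pi>0 n D"
    and "0 < \<delta>" and "\<delta> \<le> 1"
    and "lam > 0"
  shows "(\<forall>L::enat. L \<ge> 1 \<longrightarrow>
            (\<exists>h. is_arg_min (U_bound \<pi>0 n D \<delta> lam L \<pi>) (\<lambda>h. h \<in> regularizers) h))
       \<and> (\<forall>L::enat. L > 1 \<longrightarrow> U_min \<pi>0 n D \<delta> lam L \<pi> \<le> U_min \<pi>0 n D \<delta> lam 1 \<pi>)
       \<and> U_min \<pi>0 n D \<delta> lam \<infinity> \<pi> \<le> U_min \<pi>0 n D \<delta> lam 1 \<pi>"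
  using U_bound_attains_min[OF assms(5,8)] U_min_le_one[OF assms(5,8)] by (simp add: less_imp_le)

end
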